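(* In the asymptotic setting described in the context, for each policy $\pi\in\{\text{DTD},\text{OR}\}$, the optimal value $V^\pi_n(X)$ of the basic-VRPSD on the first $n$ customers satisfies $$\lim_{n\to\infty}\frac{V^\pi_n(X)}{n}=\frac{2\mu\bar d}{Q}\qquad\text{almost surely.}$$
   Context: **Setting.** Let $\mathcal{R}\subset\mathbb{R}^2$ be compact, and let $(X_i,\xi_i)_{i\ge1}$ be i.i.d. random variables on $\mathcal{R}\times\mathbb{R}_{\ge0}$, with $\xi_i$ (demand of customer $i$) independent of $X_i$ (location of customer $i$). $Q>0$ is the vehicle capacity, $\mu=\mathbb{E}[\xi_i]\in(0,\infty)$, $\bar d=\mathbb{E}\|X_i\|\in(0,\infty)$ (Euclidean norm). The depot $0$ is at the origin $X_0$. Travel costs are $c_{i,j}=\|X_i-X_j\|$; failure cost $c^F_i=2\|X_i\|$; preventive return cost $c^P_{i,j}=\|X_i\|+\|X_j\|-\|X_i-X_j\|$ (no penalty terms; $c^P_{0,j}=0$). **Routes and recourse (conditional on locations; expectations below are over demands only).** A path is a nonempty sequence $p=(i_1,\dots,i_t)$ of distinct customers; with $i_0=i_{t+1}=0$, $L(p)=\sum_{j=0}^t\|X_{i_j}-X_{i_{j+1}}\|$. - DTD (detour-to-depot): $\bar{\mathcal{Q}}^{\text{DTD}}_p=\sum_{j=1}^t\sum_{l\ge1}\mathbb{P}\left[\sum_{k<j}\xi_{i_k}\le lQ<\sum_{k\le j}\xi_{i_k}\right]c^F_{i_j}$. - OR (optimal restocking): with $\Psi(s,q)=\max\{\lceil(s-q)/Q\rceil,0\}$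 and $q\in[0,Q]$, set $F^p_{i_t}(q)=0$ and, for $j<t$, $F^p_{i_j}(q)=\min\{H^p_{i_{j+1}}(q),c^P_{i_j,i_{j+1}}+H^p_{i_{j+1}}(Q)\}$, where $H^p_i(q)=\mathbb{E}[c^F_i\Psi(\xi_i,q)+F^p_i(\Psi(\xi_i,q)Q+q-\xi_i)]$; $\bar{\mathcal{Q}}^{\text{OR}}_p=F^p_{i_0}(Q)$. $\mathcal{Q}^\pi_p$ is the minimum of $\bar{\mathcal{Q}}^\pi$ over $p$ and its reversal. **Basic-VRPSD.** $V^\pi_n(X)$ is the minimum, over all partitions of $\{1,\dots,n\}$ into any number of paths (no restriction on the number of routes nor on their expected demand), of $\sum_p(L(p)+\mathcal{Q}^\pi_p)$. *)

theory Defs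
  imports "HOL-Probability.Probability"
begin

datatype policy = DTD | OR

text \<open>
  Customers are the numbers \<open>1, 2, \<dots>\<close> and \<open>0\<close> is the depot. All cost functions below take the
  realised locations \<open>x :: nat \<Rightarrow> real^2\<close>, where \<open>x 0\<close> is the depot location (the origin), as a
  deterministic argument. Probabilities and expectations are taken under \<open>M\<close> over the demands
  \<open>\<xi>\<close> only; as the demands are independent of the locations, this amounts to conditioning on the
  locations.
\<close>

definition failure_cost :: "(nat \<Rightarrow> real^2) \<Rightarrow> nat \<Rightarrow> real" where
  "failure_cost x i = 2 * norm (x i)"

text \<open>If \<open>x 0 = 0\<close> then \<open>preventive_cost x 0 j = 0\<close>.\<close>

definition preventive_cost :: "(nat \<Rightarrow> real^2) \<Rightarrow> nat \<Rightarrow> nat \<Rightarrow> real" where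
  "preventive_cost x i j = norm (x i) + norm (x j) - dist (x i) (x j)"

definition path_length :: "(nat \<Rightarrow> real^2) \<Rightarrow> nat list \<Rightarrow> real" where
  "path_length x p =
     (let r = 0 # p @ [0] in \<Sum>j\<le>length p. dist (x (r ! j)) (x (r ! Suc j)))"

text \<open>
  Positions in the list \<open>p\<close> are counted from \<open>0\<close>, and the summation index \<open>l \<ge> 1\<close> is written
  as \<open>Suc l\<close>.
\<close>

definition dtd_recourse ::
    "'a measure \<Rightarrow> (nat \<Rightarrow> 'a \<Rightarrow> real) \<Rightarrow> real \<Rightarrow> (nat \<Rightarrow> real^2) \<Rightarrow> nat list \<Rightarrow> real" where
  "dtd_recourse M \<xi> Q x p =
     (\<Sum>j<length p. \<Sum>l.
        measure M {\<omega> \<in> space M. (\<Sum>k<j. \<xi> (p ! k) \<omega>) \<le> real (Suc l) * Q \<and>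
                               real (Suc l) * Q < (\<Sum>k\<le>j. \<xi> (p ! k) \<omega>)}
        * failure_cost x (p ! j))"

definition failures :: "real \<Rightarrow> real \<Rightarrow> real \<Rightarrow> int" where
  "failures Q s q = max \<lceil>(s - q) / Q\<rceil> 0"

text \<open>
  \<open>serve_cost M \<xi> Q x i F q\<close> is the expected cost of visiting customer \<open>i\<close> with remaining
  load \<open>q\<close>, where \<open>F\<close> is the cost-to-go after \<open>i\<close> as a function of the remaining load.
\<close>

definition serve_cost ::
    "'a measure \<Rightarrow> (nat \<Rightarrow> 'a \<Rightarrow> real) \<Rightarrow> real \<Rightarrow> (nat \<Rightarrow> real^2) \<Rightarrow>
     nat \<Rightarrow> (real \<Rightarrow> real) \<Rightarrow> real \<Rightarrow> real" where
  "serve_cost M \<xi> Q x i F q =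
     (\<integral>\<omega>. failure_cost x i * real_of_int (failures Q (\<xi> i \<omega>) q)
          + F (real_of_int (failures Q (\<xi> i \<omega>) q) * Q + q - \<xi> i \<omega>) \<partial>M)"

text \<open>
  \<open>cost_to_go M \<xi> Q x js i q\<close> is the optimal expected recourse cost when the vehicle has just
  served \<open>i\<close>, has remaining load \<open>q\<close>, and still has to visit the customers \<open>js\<close> in this order.
\<close>

primrec cost_to_go ::
    "'a measure \<Rightarrow> (nat \<Rightarrow> 'a \<Rightarrow> real) \<Rightarrow> real \<Rightarrow> (nat \<Rightarrow> real^2) \<Rightarrow>
     nat list \<Rightarrow> nat \<Rightarrow> real \<Rightarrow> real" where
  "cost_to_go M \<xi> Q x [] i q = 0"
| "cost_to_go M \<xi> Q x (j # js) i q =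
     min (serve_cost M \<xi> Q x j (cost_to_go M \<xi> Q x js j) q)
         (preventive_cost x i j + serve_cost M \<xi> Q x j (cost_to_go M \<xi> Q x js j) Q)"

primrec directed_recourse ::
    "policy \<Rightarrow> 'a measure \<Rightarrow> (nat \<Rightarrow> 'a \<Rightarrow> real) \<Rightarrow> real \<Rightarrow> (nat \<Rightarrow> real^2) \<Rightarrow>
     nat list \<Rightarrow> real" where
  "directed_recourse DTD M \<xi> Q x p = dtd_recourse M \<xi> Q x p"
| "directed_recourse OR M \<xi> Q x p = cost_to_go M \<xi> Q x p 0 Q"

definition recourse ::
    "policy \<Rightarrow> 'a measure \<Rightarrow> (nat \<Rightarrow> 'a \<Rightarrow> real) \<Rightarrow> real \<Rightarrow> (nat \<Rightarrow> real^2) \<Rightarrow>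
     nat list \<Rightarrow> real" where
  "recourse \<pi> M \<xi> Q x p =
     min (directed_recourse \<pi> M \<xi> Q x p) (directed_recourse \<pi> M \<xi> Q x (rev p))"

definition route_plans :: "nat \<Rightarrow> nat list set set" where
  "route_plans n = {P. (\<forall>p\<in>P. p \<noteq> [] \<and> distinct p) \<and>
                       disjoint_family_on set P \<and> (\<Union>p\<in>P. set p) = {1..n}}"

definition vrpsd_value ::
    "policy \<Rightarrow> 'a measure \<Rightarrow> (nat \<Rightarrow> 'a \<Rightarrow> real) \<Rightarrow> real \<Rightarrow> (nat \<Rightarrow> real^2) \<Rightarrow> nat \<Rightarrow> real" where
  "vrpsd_value \<pi> M \<xi> Q x n =
     Min ((\<lambda>P. \<Sum>p\<in>P. path_length x p + recourse \<pi> M \<xi> Q x p) ` route_plans n)"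

text \<open>The minimum ranges over a finite nonempty set, and every route plan is a finite set of paths.\<close>

lemma route_plans_subset:
  "route_plans n \<subseteq> Pow {p. set p \<subseteq> {1..n} \<and> distinct p}"
  unfolding route_plans_def by blast

lemma finite_distinct_lists: "finite {p. set p \<subseteq> {1..n::nat} \<and> distinct p}"
  by (rule finite_subset[OF _ finite_lists_length_le[of "{1..n}" n]])
     (auto simp flip: distinct_card dest: card_mono[rotated])

lemma finite_route_plans: "finite (route_plans n)"
  using finite_subset[OF route_plans_subset] finite_distinct_lists by blast

lemma finite_route_plan: "P \<in> route_plans n \<Longrightarrow> finite P"
  using finite_subset[OF _ finite_distinct_lists] route_plans_subset by blast

lemma route_plans_nonempty: "route_plans n \<noteq> {}"
proof -
  have "(\<lambda>i. [i]) ` {1..n} \<in> route_plans n"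
    by (auto simp: route_plans_def disjoint_family_on_def)
  then show ?thesis by blast
qed

end

theory Submission
  imports Defs
begin

text \<open>
  For both policies the expected recourse cost of a path \<open>p\<close> differs from
  \<open>2 * \<mu> / Q * (\<Sum>i\<in>set p. norm (x i))\<close> by at most the length of \<open>p\<close>. Hence the value lies between
  \<open>2 * \<mu> / Q * (\<Sum>i=1..n. norm (x i))\<close> and the same quantity plus twice the total length of any
  route plan. Covering the compact region by finitely many sets of small diameter and serving each
  of them by one path gives plans of total length \<open>o(n)\<close>, and the strong law of large numbers
  (for bounded variables: Hoeffding's inequality and Borel--Cantelli) identifies the limit. For
  detour-to-depot the recourse estimate is a summation by parts; for optimal restocking it is an
  induction along the path in which the term \<open>norm (x i) * (1 - 2 * q / Q)\<close> tracks the load \<open>q\<close>.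
\<close>

section \<open>Lengths of paths\<close>

text \<open>Recurses from the front like \<open>cost_to_go\<close>, so that recourse bounds can be
  proved by induction along the path; the base value is the leg home to the depot at the
  origin.\<close>

primrec tour_length :: "(nat \<Rightarrow> real^2) \<Rightarrow> nat list \<Rightarrow> nat \<Rightarrow> real" where
  "tour_length x [] i = norm (x i)"
| "tour_length x (j # js) i = dist (x i) (x j) + tour_length x js j"

lemma path_length_eq_tour_length:
  assumes "x 0 = 0"
  shows "path_length x p = tour_length x p 0"
proof -
  have "(\<Sum>j\<le>length p. dist (x ((i # p @ [0]) ! j)) (x ((i # p @ [0]) ! Suc j))) = tour_length x p i"
    for i
  proof (induction p arbitrary: i)
    case Nil
    then show ?case by (simp add: assms)
  next
    case (Cons j p)
    show ?case
      using Cons.IH[of j] by (simp add: sum.atMost_Suc_shift del: sum.atMost_Suc)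
  qed
  then show ?thesis
    by (simp add: path_length_def)
qed

text \<open>Needed because \<open>recourse\<close> takes the cheaper direction. Reversal maps leg
  \<open>j\<close> to leg \<open>length p - j\<close> with its endpoints swapped.\<close>

lemma path_length_rev: "path_length x (rev p) = path_length x p"
proof -
  define r where "r = 0 # p @ [0]"
  have len: "length r = length p + 2" and rev: "0 # rev p @ [0] = rev r"
    by (simp_all add: r_def)
  have "(\<Sum>j\<le>length p. dist (x (rev r ! j)) (x (rev r ! Suc j))) =
        (\<Sum>j\<le>length p. dist (x (r ! j)) (x (r ! Suc j)))"
  proof (rule sum.reindex_bij_witness[where i = "\<lambda>j. length p - j" and j = "\<lambda>j. length p - j"])
    fix j assume "j \<in> {..length p}"
    then have "rev r ! j = r ! Suc (length p - j)" "rev r ! Suc j = r ! (length p - j)"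
      by (simp_all add: rev_nth len Suc_diff_le)
    then show "dist (x (r ! (length p - j))) (x (r ! Suc (length p - j))) =
               dist (x (rev r ! j)) (x (rev r ! Suc j))"
      by (simp add: dist_commute)
  qed auto
  then show ?thesis
    unfolding path_length_def Let_def length_rev rev r_def[symmetric] .
qed

lemma tour_length_le:
  assumes "\<And>a b. a \<in> set (i # js) \<Longrightarrow> b \<in> set (i # js) \<Longrightarrow> dist (x a) (x b) \<le> \<epsilon>"
    and "\<And>a. a \<in> set (i # js) \<Longrightarrow> norm (x a) \<le> B"
  shows "tour_length x js i \<le> \<epsilon> * length js + B"
  using assms
proof (induction js arbitrary: i)
  case (Cons j js)
  have "tour_length x js j \<le> \<epsilon> * length js + B"
    by (rule Cons.IH) (auto intro: Cons.prems)
  moreover have "dist (x i) (x j) \<le> \<epsilon>"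
    by (rule Cons.prems(1)) auto
  ultimately show ?case
    by (simp add: algebra_simps)
qed auto

text \<open>The legs from and to the depot account for \<open>2 * B\<close>. Only
  \<open>length p - 1\<close> legs join customers; \<open>0 \<le> \<epsilon>\<close> allows rounding
  this up to \<open>length p\<close>.\<close>

lemma path_length_le:
  assumes "x 0 = 0" and "0 \<le> \<epsilon>" and "p \<noteq> []"
    and "\<And>a b. a \<in> set p \<Longrightarrow> b \<in> set p \<Longrightarrow> dist (x a) (x b) \<le> \<epsilon>"
    and "\<And>a. a \<in> set p \<Longrightarrow> norm (x a) \<le> B"
  shows "path_length x p \<le> \<epsilon> * length p + 2 * B"
proof -
  obtain j js where p: "p = j # js"
    using assms(3) by (cases p) auto
  have "tour_length x js j \<le> \<epsilon> * length js + B"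
    using assms(4,5) unfolding p by (rule tour_length_le)
  moreover have "norm (x j) \<le> B"
    using assms(5) p by simp
  ultimately show ?thesis
    using assms(1,2) by (simp add: path_length_eq_tour_length p algebra_simps)
qed

section \<open>Charging changes of norm to legs\<close>

text \<open>Both recourse estimates carry a term \<open>norm (x i) * t\<close> along the path; its
  change when \<open>i\<close> is replaced by the next customer is charged to the leg between
  them.\<close>

lemma abs_norm_diff_mult_le_dist:
  fixes a b :: "'v::real_normed_vector"
  assumes "\<bar>t\<bar> \<le> 1"
  shows "\<bar>(norm a - norm b) * t\<bar> \<le> dist a b"
proof -
  have "\<bar>(norm a - norm b) * t\<bar> \<le> \<bar>norm a - norm b\<bar>"
    using mult_left_mono[OF assms abs_ge_zero[of "norm a - norm b"]] by (simp add: abs_mult)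
  also have "\<dots> \<le> dist a b"
    by (simp add: dist_norm norm_triangle_ineq3)
  finally show ?thesis .
qed

text \<open>Summation by parts: the coefficient of each leg is \<open>2 * \<theta> j - 1\<close>, of modulus at most 1.\<close>

lemma abs_weighted_sum_le_tour_length:
  fixes \<theta> :: "nat \<Rightarrow> real"
  assumes "\<And>j. 0 \<le> \<theta> j \<and> \<theta> j \<le> 1"
  shows "\<bar>(\<Sum>j<length p. 2 * norm (x (p ! j)) * (\<theta> (Suc j) - \<theta> j)) + norm (x i) * (2 * \<theta> 0 - 1)\<bar>
          \<le> tour_length x p i"
  using assms
proof (induction p arbitrary: i \<theta>)
  case Nil
  have "\<bar>2 * \<theta> 0 - 1\<bar> \<le> 1"
    using Nil.prems[of 0] by (simp add: abs_le_iff)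
  then show ?case
    by (simp add: abs_mult mult_left_le)
next
  case (Cons j p)
  define s where "s = (\<Sum>k<length p. 2 * norm (x (p ! k)) * (\<theta> (Suc (Suc k)) - \<theta> (Suc k)))"
  have "\<bar>s + norm (x j) * (2 * \<theta> (Suc 0) - 1)\<bar> \<le> tour_length x p j"
    using Cons.IH[of "\<lambda>k. \<theta> (Suc k)" j] Cons.prems by (simp add: s_def)
  moreover have "\<bar>(norm (x i) - norm (x j)) * (2 * \<theta> 0 - 1)\<bar> \<le> dist (x i) (x j)"
    using Cons.prems[of 0] by (intro abs_norm_diff_mult_le_dist) auto
  \<comment> \<open>The head summand is \<open>norm (x j) * (2 * \<theta> (Suc 0) - 1)\<close>,
    which completes the shifted induction hypothesis, minus
    \<open>norm (x j) * (2 * \<theta> 0 - 1)\<close>, which pairs with the term of \<open>i\<close>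
    to form the new leg.\<close>
  moreover have "(\<Sum>k<length (j # p). 2 * norm (x ((j # p) ! k)) * (\<theta> (Suc k) - \<theta> k)) +
                  norm (x i) * (2 * \<theta> 0 - 1) =
                (s + norm (x j) * (2 * \<theta> (Suc 0) - 1)) + (norm (x i) - norm (x j)) * (2 * \<theta> 0 - 1)"
    by (simp add: s_def sum.lessThan_Suc_shift algebra_simps del: sum.lessThan_Suc)
  ultimately show ?case
    unfolding tour_length.simps by linarith
qed

section \<open>Route plans and the optimal value\<close>

lemma sum_over_route_plan:
  fixes f :: "nat \<Rightarrow> real"
  assumes "P \<in> route_plans n"
  shows "(\<Sum>p\<in>P. \<Sum>i\<in>set p. f i) = (\<Sum>i=1..n. f i)"
proof -
  have "(\<Sum>i\<in>(\<Union>p\<in>P. set p). f i) = (\<Sum>p\<in>P. \<Sum>i\<in>set p. f i)"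
    using assms finite_route_plan[OF assms]
    by (intro sum.UNION_disjoint) (auto simp: route_plans_def disjoint_family_on_def)
  then show ?thesis
    using assms by (simp add: route_plans_def)
qed

text \<open>The recourse of a path falls short of its linear term by at most the path length, which
  the travel cost makes up; hence the lower bound has no error. The upper bound pays the length
  twice, as travel and as recourse error.\<close>

lemma vrpsd_value_bounds:
  assumes rec: "\<And>p. distinct p \<Longrightarrow> set p \<subseteq> {1..n} \<Longrightarrow>
      \<bar>recourse \<pi> M \<xi> Q x p - c * (\<Sum>i\<in>set p. norm (x i))\<bar> \<le> path_length x p"
  shows "c * (\<Sum>i=1..n. norm (x i)) \<le> vrpsd_value \<pi> M \<xi> Q x n"
    and "P \<in> route_plans n \<Longrightarrow>
      vrpsd_value \<pi> M \<xi> Q x n \<le> c * (\<Sum>i=1..n. norm (x i)) + 2 * (\<Sum>p\<in>P. path_length x p)"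
proof -
  let ?C = "\<lambda>P. \<Sum>p\<in>P. path_length x p + recourse \<pi> M \<xi> Q x p"
  let ?S = "\<lambda>p. c * (\<Sum>i\<in>set p. norm (x i))"
  have total: "(\<Sum>p\<in>P. ?S p) = c * (\<Sum>i=1..n. norm (x i))" if "P \<in> route_plans n" for P
    by (simp add: sum_over_route_plan[OF that] flip: sum_distrib_left)
  have rec': "?S p \<le> path_length x p + recourse \<pi> M \<xi> Q x p \<and>
      path_length x p + recourse \<pi> M \<xi> Q x p \<le> ?S p + 2 * path_length x p"
    if "P \<in> route_plans n" "p \<in> P" for P p
  proof -
    have "distinct p" "set p \<subseteq> {1..n}"
      using that by (auto simp: route_plans_def)
    from rec[OF this] show ?thesis by linarith
  qed
  have "(\<Sum>p\<in>P. ?S p) \<le> ?C P" if "P \<in> route_plans n" for P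
    using rec'[OF that] by (intro sum_mono) auto
  then show "c * (\<Sum>i=1..n. norm (x i)) \<le> vrpsd_value \<pi> M \<xi> Q x n"
    unfolding vrpsd_value_def using finite_route_plans route_plans_nonempty total
    by (intro Min.boundedI) auto
  assume P: "P \<in> route_plans n"
  have "vrpsd_value \<pi> M \<xi> Q x n \<le> ?C P"
    unfolding vrpsd_value_def using finite_route_plans P by (intro Min_le) auto
  also have "\<dots> \<le> (\<Sum>p\<in>P. ?S p + 2 * path_length x p)"
    using rec'[OF P] by (intro sum_mono) auto
  also have "\<dots> = c * (\<Sum>i=1..n. norm (x i)) + 2 * (\<Sum>p\<in>P. path_length x p)"
    using total[OF P] by (simp add: sum.distrib sum_distrib_left)
  finally show "vrpsd_value \<pi> M \<xi> Q x n \<le> c * (\<Sum>i=1..n. norm (x i)) + 2 * (\<Sum>p\<in>P. path_length x p)" .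
qed

text \<open>One path per cluster, in any order: legs inside a cluster cost at most \<epsilon>, and
  each of the at most \<open>card K\<close> paths adds two depot legs.\<close>

lemma cluster_route_plan:
  fixes g :: "nat \<Rightarrow> 'c"
  assumes "x 0 = 0" "0 \<le> \<epsilon>" "0 \<le> B" "finite K" "\<And>i. i \<in> {1..n} \<Longrightarrow> g i \<in> K"
    and "\<And>i j. i \<in> {1..n} \<Longrightarrow> j \<in> {1..n} \<Longrightarrow> g i = g j \<Longrightarrow> dist (x i) (x j) \<le> \<epsilon>"
    and "\<And>i. i \<in> {1..n} \<Longrightarrow> norm (x i) \<le> B"
  obtains P where "P \<in> route_plans n"
    and "(\<Sum>p\<in>P. path_length x p) \<le> \<epsilon> * n + 2 * B * card K"
proof
  define cl where "cl k = sorted_list_of_set {i\<in>{1..n}. g i = k}" for k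
  \<comment> \<open>Only the labels that occur are used, so that no path is empty.\<close>
  define P where "P = cl ` g ` {1..n}"
  have set_cl: "set (cl k) = {i\<in>{1..n}. g i = k}" for k
    by (simp add: cl_def)
  show P: "P \<in> route_plans n"
    unfolding route_plans_def
  proof (intro CollectI conjI ballI)
    fix p assume "p \<in> P"
    then obtain i where i: "i \<in> {1..n}" "p = cl (g i)"
      by (auto simp: P_def)
    then have "i \<in> set p"
      by (simp add: set_cl)
    then show "p \<noteq> []" by auto
    show "distinct p"
      by (simp add: i cl_def)
  next
    show "disjoint_family_on set P"
      by (auto simp: disjoint_family_on_def P_def set_cl)
    show "(\<Union>p\<in>P. set p) = {1..n}"
      by (auto simp: P_def set_cl)
  qed
  \<comment> \<open>Writing the leg costs as a sum over \<open>set p\<close> lets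
    \<open>sum_over_route_plan\<close> collect them into \<open>\<epsilon> * n\<close>.\<close>
  have "(\<Sum>p\<in>P. path_length x p) \<le> (\<Sum>p\<in>P. (\<Sum>i\<in>set p. \<epsilon>) + 2 * B)"
  proof (rule sum_mono)
    fix p assume p: "p \<in> P"
    have "distinct p" "p \<noteq> []"
      using p P by (auto simp: route_plans_def)
    have "path_length x p \<le> \<epsilon> * length p + 2 * B"
      using p assms(6,7)
      by (intro path_length_le assms(1,2) \<open>p \<noteq> []\<close>) (auto simp: P_def set_cl)
    then show "path_length x p \<le> (\<Sum>i\<in>set p. \<epsilon>) + 2 * B"
      by (simp add: distinct_card[OF \<open>distinct p\<close>] mult.commute)
  qed
  also have "\<dots> = \<epsilon> * n + 2 * B * card P"
    by (simp only: sum.distrib sum_over_route_plan[OF P]) simp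
  also have "card P \<le> card (g ` {1..n})"
    unfolding P_def by (intro card_image_le) simp
  also have "card (g ` {1..n}) \<le> card K"
    using assms(4,5) by (intro card_mono) auto
  finally show "(\<Sum>p\<in>P. path_length x p) \<le> \<epsilon> * n + 2 * B * card K"
    using assms(3) by (simp add: mult_left_mono)
qed

section \<open>Limit of the value for fixed locations\<close>

text \<open>\<open>C\<close> may depend on \<epsilon>, as the number of clusters does: for fixed
  \<epsilon> the term \<open>C / n\<close> still vanishes.\<close>

lemma tendsto_zero_of_abs_le:
  fixes f :: "nat \<Rightarrow> real"
  assumes "\<And>\<epsilon>. \<epsilon> > 0 \<Longrightarrow> \<exists>C. \<forall>n\<ge>1. \<bar>f n\<bar> \<le> \<epsilon> + C / n"
  shows "f \<longlonglongrightarrow> 0"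
proof (rule tendstoI)
  fix e :: real assume "e > 0"
  then obtain C where C: "\<And>n. n \<ge> 1 \<Longrightarrow> \<bar>f n\<bar> \<le> e / 2 + C / n"
    using assms[of "e / 2"] by auto
  have "(\<lambda>n. e / 2 + C / real n) \<longlonglongrightarrow> e / 2 + 0"
    by (intro tendsto_intros lim_const_over_n)
  then have "eventually (\<lambda>n. e / 2 + C / real n < e) sequentially"
    using \<open>e > 0\<close> by (elim order_tendstoD) auto
  then show "eventually (\<lambda>n. dist (f n) 0 < e) sequentially"
    using eventually_ge_at_top[of 1]
    by eventually_elim (use C in force)
qed

lemma vrpsd_value_asymptotics:
  fixes x :: "nat \<Rightarrow> real^2"
  assumes "x 0 = 0" and R: "compact R" "\<And>i. i \<ge> 1 \<Longrightarrow> x i \<in> R"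
    and rec: "\<And>p. distinct p \<Longrightarrow> 0 \<notin> set p \<Longrightarrow>
      \<bar>recourse \<pi> M \<xi> Q x p - c * (\<Sum>i\<in>set p. norm (x i))\<bar> \<le> path_length x p"
    and lim: "(\<lambda>n. (\<Sum>i=1..n. norm (x i)) / n) \<longlonglongrightarrow> d"
  shows "(\<lambda>n. vrpsd_value \<pi> M \<xi> Q x n / n) \<longlonglongrightarrow> c * d"
proof -
  obtain B where B: "B > 0" "\<And>r. r \<in> R \<Longrightarrow> norm r \<le> B"
    using compact_imp_bounded[OF R(1)] bounded_pos by metis
  have "\<exists>C. \<forall>n\<ge>1. \<bar>vrpsd_value \<pi> M \<xi> Q x n / n - c * ((\<Sum>i=1..n. norm (x i)) / n)\<bar> \<le> \<epsilon> + C / n"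
    if \<epsilon>: "\<epsilon> > 0" for \<epsilon>
  proof -
    \<comment> \<open>Radius \<open>\<epsilon> / 4\<close> gives clusters of diameter at most
      \<open>\<epsilon> / 2\<close>, and path lengths count twice in the upper bound.\<close>
    obtain K where K: "finite K" "R \<subseteq> (\<Union>k\<in>K. ball k (\<epsilon> / 4))"
      using R(1) \<epsilon> unfolding compact_eq_totally_bounded
      by (metis divide_pos_pos zero_less_numeral)
    have "\<forall>i\<in>{1..}. \<exists>k\<in>K. x i \<in> ball k (\<epsilon> / 4)"
      using R(2) K(2) by fastforce
    then obtain g where g: "\<And>i. i \<ge> 1 \<Longrightarrow> g i \<in> K \<and> x i \<in> ball (g i) (\<epsilon> / 4)"
      by (metis atLeast_iff)
    have close: "dist (x i) (x j) \<le> \<epsilon> / 2" if "i \<ge> 1" "j \<ge> 1" "g i = g j" for i j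
      using g[OF that(1)] g[OF that(2)] that(3) dist_triangle3[of "x i" "x j" "g i"] by simp
    have "\<bar>vrpsd_value \<pi> M \<xi> Q x n / n - c * ((\<Sum>i=1..n. norm (x i)) / n)\<bar>
            \<le> \<epsilon> + 4 * B * card K / n" if "n \<ge> 1" for n
    proof -
      obtain P where P: "P \<in> route_plans n"
        "(\<Sum>p\<in>P. path_length x p) \<le> \<epsilon> / 2 * n + 2 * B * card K"
        by (rule cluster_route_plan[of x "\<epsilon> / 2" B K n g])
           (use assms(1) \<epsilon> B K(1) g close R(2) in auto)
      have "\<bar>vrpsd_value \<pi> M \<xi> Q x n - c * (\<Sum>i=1..n. norm (x i))\<bar> \<le> \<epsilon> * n + 4 * B * card K"
        using vrpsd_value_bounds[of n \<pi> M \<xi> Q x c] rec P by fastforce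
      then have "\<bar>vrpsd_value \<pi> M \<xi> Q x n - c * (\<Sum>i=1..n. norm (x i))\<bar> / n
                  \<le> (\<epsilon> * n + 4 * B * card K) / n"
        by (intro divide_right_mono) auto
      moreover have "\<bar>vrpsd_value \<pi> M \<xi> Q x n - c * (\<Sum>i=1..n. norm (x i))\<bar> / n =
        \<bar>vrpsd_value \<pi> M \<xi> Q x n / n - c * ((\<Sum>i=1..n. norm (x i)) / n)\<bar>"
        using that by (simp add: abs_div_pos diff_divide_distrib)
      ultimately show ?thesis
        using that by (simp add: add_divide_distrib)
    qed
    then show ?thesis by blast
  qed
  then have "(\<lambda>n. vrpsd_value \<pi> M \<xi> Q x n / n - c * ((\<Sum>i=1..n. norm (x i)) / n)) \<longlonglongrightarrow> 0"
    by (rule tendsto_zero_of_abs_le)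
  from tendsto_add[OF this tendsto_mult_left[OF lim, of c]] show ?thesis
    by simp
qed

section \<open>Load after a visit\<close>

text \<open>The ceiling is the least number of full loads covering the shortfall, so less than one
  load is left over. This keeps the argument of the cost-to-go in the range where its bound is
  known.\<close>

lemma failures_load:
  assumes "Q > 0" "0 \<le> s" "0 \<le> q" "q \<le> Q"
  shows "real_of_int (failures Q s q) * Q + q - s \<in> {0..Q}"
proof (cases "s \<le> q")
  case True
  then have "(s - q) / Q \<le> 0"
    using \<open>Q > 0\<close> by (simp add: divide_nonpos_pos)
  then have "\<lceil>(s - q) / Q\<rceil> \<le> 0"
    by linarith
  then have "failures Q s q = 0"
    by (simp add: failures_def)
  then show ?thesis
    using True assms by simp
next
  case False
  then have "(s - q) / Q > 0"
    using \<open>Q > 0\<close> by simp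
  then have "failures Q s q = \<lceil>(s - q) / Q\<rceil>"
    unfolding failures_def by linarith
  moreover have "s - q \<le> real_of_int \<lceil>(s - q) / Q\<rceil> * Q"
    using \<open>Q > 0\<close> by (simp flip: pos_divide_le_eq)
  moreover have "real_of_int \<lceil>(s - q) / Q\<rceil> < (s - q) / Q + 1"
    by linarith
  ultimately show ?thesis
    using \<open>Q > 0\<close> by (simp add: field_simps)
qed

context prob_space
begin

section \<open>Strong law of large numbers for bounded variables\<close>

lemma strong_law_bounded:
  fixes Y :: "nat \<Rightarrow> 'a \<Rightarrow> real"
  assumes indep: "indep_vars (\<lambda>_. borel) Y {1..}"
    and distr: "\<And>i. i \<ge> 1 \<Longrightarrow> distr M borel (Y i) = distr M borel (Y 1)"
    and bounded: "AE \<omega> in M. Y 1 \<omega> \<in> {a..b}" and "a < b"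
  shows "AE \<omega> in M. (\<lambda>n. (\<Sum>i=1..n. Y i \<omega>) / n) \<longlonglongrightarrow> expectation (Y 1)"
proof -
  have Y [measurable]: "Y i \<in> borel_measurable M" if "i \<ge> 1" for i
    using indep that by (auto simp: indep_vars_def)
  define m where "m = expectation (Y 1)"
  let ?A = "\<lambda>e n. {\<omega>\<in>space M. \<bar>(\<Sum>i=1..n. Y i \<omega>) / n - m\<bar> \<ge> e}"
  have meas: "?A e n \<in> sets M" for e n
    by measurable
  have "AE \<omega> in M. eventually (\<lambda>n. \<bar>(\<Sum>i=1..n. Y i \<omega>) / n - m\<bar> < e) sequentially"
    if "e > 0" for e
  proof -
    \<comment> \<open>Chosen so that Hoeffding's bound for the mean of \<open>n\<close> variables
      reads \<open>2 * exp (- t) ^ n\<close>, which is summable in \<open>n\<close>.\<close>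
    define t where "t = 2 * e\<^sup>2 / (b - a)\<^sup>2"
    have "t > 0"
      using that \<open>a < b\<close> by (simp add: t_def)
    have le: "prob (?A e n) \<le> 2 * exp (- t) ^ n" for n
    proof (cases "n = 0")
      \<comment> \<open>The empty sample is outside Hoeffding's bound, but here the right-hand side
        is 2.\<close>
      case True
      then show ?thesis by (intro order_trans[OF prob_le_1]) simp
    next
      case False
      interpret H: Hoeffding_ineq_iid M "{1..n}" Y "Y 1" a b m
      proof unfold_locales
        show "indep_vars (\<lambda>_. borel) Y {1..n}"
          by (rule indep_vars_subset[OF indep]) auto
        show "distr M borel (Y i) = distr M borel (Y 1)" if "i \<in> {1..n}" for i
          by (rule distr) (use that in simp)
        show "Y 1 \<in> borel_measurable M"
          by (rule Y) simp
        show "AE \<omega> in M. Y 1 \<omega> \<in> {a..b}"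
          by (rule bounded)
      qed (simp_all add: m_def)
      have "prob (?A e n) \<le> 2 * exp (- 2 * n * e\<^sup>2 / (b - a)\<^sup>2)"
        using H.Hoeffding_ineq_abs_ge'[of e] that \<open>a < b\<close> False by simp
      also have "- 2 * n * e\<^sup>2 / (b - a)\<^sup>2 = real n * (- t)"
        by (simp add: t_def)
      finally show ?thesis
        by (simp only: exp_of_nat_mult)
    qed
    have "summable (\<lambda>n. prob (?A e n))"
    proof (rule summable_comparison_test')
      show "summable (\<lambda>n. 2 * exp (- t) ^ n)"
        using \<open>t > 0\<close> by (intro summable_mult summable_geometric) simp
      show "norm (prob (?A e n)) \<le> 2 * exp (- t) ^ n" if "n \<ge> 0" for n
        using le[of n] by (simp only: real_norm_def abs_of_nonneg[OF measure_nonneg])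
    qed
    then have "AE \<omega> in M. eventually (\<lambda>n. \<omega> \<in> space M - ?A e n) sequentially"
      by (intro borel_cantelli_AE1 meas) (auto simp: emeasure_eq_measure less_top[symmetric])
    then show ?thesis
      by eventually_elim (auto elim: eventually_mono)
  qed
  \<comment> \<open>Countably many thresholds suffice for convergence, and their null sets can be
    united.\<close>
  then have "AE \<omega> in M. \<forall>k. eventually (\<lambda>n. \<bar>(\<Sum>i=1..n. Y i \<omega>) / n - m\<bar> < inverse (Suc k)) sequentially"
    by (simp add: AE_all_countable)
  then show ?thesis
    unfolding m_def[symmetric]
  proof eventually_elim
    case (elim \<omega>)
    show ?case
    proof (rule tendstoI)
      fix e :: real assume "e > 0"
      then obtain k where "inverse (Suc k) < e"
        using reals_Archimedean by blast
      then show "eventually (\<lambda>n. dist ((\<Sum>i=1..n. Y i \<omega>) / n) m < e) sequentially"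
        using elim[rule_format, of k] by (auto simp: dist_real_def elim: eventually_mono)
    qed
  qed
qed

section \<open>Recourse under detour-to-depot\<close>

text \<open>The number of \<open>l \<ge> 1\<close> with \<open>l * Q < s\<close> lies between \<open>s / Q - 1\<close> and \<open>s / Q\<close>.\<close>

lemma tail_sum_bounds:
  fixes S :: "'a \<Rightarrow> real"
  assumes "Q > 0" and [measurable]: "integrable M S" and nonneg: "\<And>\<omega>. \<omega> \<in> space M \<Longrightarrow> 0 \<le> S \<omega>"
  shows "summable (\<lambda>l. prob {\<omega>\<in>space M. real (Suc l) * Q < S \<omega>})" (is "summable ?p")
    and "(\<Sum>l. prob {\<omega>\<in>space M. real (Suc l) * Q < S \<omega>}) \<le> expectation S / Q"
    and "expectation S / Q - 1 \<le> (\<Sum>l. prob {\<omega>\<in>space M. real (Suc l) * Q < S \<omega>})"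
proof -
  have [measurable]: "S \<in> borel_measurable M"
    using assms(2) by simp
  define I :: "nat \<Rightarrow> 'a \<Rightarrow> real" where "I l = indicator {\<omega>\<in>space M. real (Suc l) * Q < S \<omega>}" for l
  have I: "integrable M (I l)" and EI: "expectation (I l) = ?p l" for l
    by (simp_all add: I_def integrable_real_indicator emeasure_eq_measure)
  \<comment> \<open>The strict inequality makes the count the ceiling minus one rather than the
    floor; \<open>nat\<close> truncates the value -1 arising when
    \<open>S \<omega> = 0\<close>.\<close>
  have I_eq: "I l \<omega> = (if l < nat (\<lceil>S \<omega> / Q\<rceil> - 1) then 1 else 0)" if "\<omega> \<in> space M" for l \<omega>
  proof -
    have "real (Suc l) * Q < S \<omega> \<longleftrightarrow> real_of_int (int l + 1) < S \<omega> / Q"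
      using \<open>Q > 0\<close> by (simp add: pos_less_divide_eq add.commute)
    also have "\<dots> \<longleftrightarrow> l < nat (\<lceil>S \<omega> / Q\<rceil> - 1)"
      unfolding less_ceiling_iff[symmetric] by linarith
    finally show ?thesis
      using that by (simp add: I_def)
  qed
  have count: "real (nat (\<lceil>S \<omega> / Q\<rceil> - 1)) \<le> S \<omega> / Q" "S \<omega> / Q - 1 \<le> real (nat (\<lceil>S \<omega> / Q\<rceil> - 1))"
    if "\<omega> \<in> space M" for \<omega>
  proof -
    have "0 \<le> S \<omega> / Q"
      using \<open>Q > 0\<close> nonneg[OF that] by simp
    then show "real (nat (\<lceil>S \<omega> / Q\<rceil> - 1)) \<le> S \<omega> / Q" "S \<omega> / Q - 1 \<le> real (nat (\<lceil>S \<omega> / Q\<rceil> - 1))"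
      by linarith+
  qed
  have sums: "(\<lambda>l. I l \<omega>) sums real (nat (\<lceil>S \<omega> / Q\<rceil> - 1))" if "\<omega> \<in> space M" for \<omega>
    using sums_If_finite[of "\<lambda>l. l < nat (\<lceil>S \<omega> / Q\<rceil> - 1)" "\<lambda>_. 1::real"]
    by (simp add: I_eq[OF that])
  \<comment> \<open>Bounded partial sums give the upper bound and also summability, on which the
    later exchange of sum and expectation relies.\<close>
  have partial: "(\<Sum>l<m. ?p l) \<le> expectation S / Q" for m
  proof -
    have "(\<Sum>l<m. ?p l) = expectation (\<lambda>\<omega>. \<Sum>l<m. I l \<omega>)"
      by (simp add: I EI)
    also have "\<dots> \<le> expectation (\<lambda>\<omega>. S \<omega> / Q)"
    proof (intro integral_mono)
      fix \<omega> assume \<omega>: "\<omega> \<in> space M"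
      have "(\<Sum>l<m. I l \<omega>) \<le> (\<Sum>l. I l \<omega>)"
        using sums_summable[OF sums[OF \<omega>]] by (intro sum_le_suminf) (auto simp: I_def)
      also have "\<dots> \<le> S \<omega> / Q"
        using count(1)[OF \<omega>] sums_unique[OF sums[OF \<omega>]] by simp
      finally show "(\<Sum>l<m. I l \<omega>) \<le> S \<omega> / Q" .
    qed (use I assms(2) in auto)
    finally show ?thesis by simp
  qed
  show *: "summable ?p"
    by (rule summableI_nonneg_bounded[OF _ partial]) simp
  show "suminf ?p \<le> expectation S / Q"
    by (rule suminf_le_const[OF * partial])
  have summ: "AE \<omega> in M. summable (\<lambda>l. norm (I l \<omega>))"
    using sums_summable[OF sums] by (auto simp: I_def)
  have summ': "summable (\<lambda>l. expectation (\<lambda>\<omega>. norm (I l \<omega>)))"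
    using * EI by (simp add: I_def)
  have "expectation S / Q - 1 = expectation (\<lambda>\<omega>. S \<omega> / Q - 1)"
    using assms(2) by (simp add: prob_space)
  also have "\<dots> \<le> expectation (\<lambda>\<omega>. \<Sum>l. I l \<omega>)"
    using count(2) sums_unique[OF sums] assms(2) integrable_suminf[OF I summ summ']
    by (intro integral_mono) auto
  also have "\<dots> = suminf ?p"
    using integral_suminf[OF I summ summ'] by (simp add: EI)
  finally show "expectation S / Q - 1 \<le> suminf ?p" .
qed

text \<open>The expected number of failures among the first \<open>j\<close> customers lags behind
  \<open>j * \<mu> / Q\<close> by an amount in \<open>[0, 1]\<close>, which is the range of weights
  that the summation by parts allows.\<close>

lemma dtd_recourse_bound:
  assumes "Q > 0" "x 0 = 0"
    and int: "\<And>j. j \<in> set p \<Longrightarrow> integrable M (\<xi> j)"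
    and nonneg: "\<And>j \<omega>. j \<in> set p \<Longrightarrow> \<omega> \<in> space M \<Longrightarrow> 0 \<le> \<xi> j \<omega>"
    and mean: "\<And>j. j \<in> set p \<Longrightarrow> expectation (\<xi> j) = \<mu>"
  shows "\<bar>dtd_recourse M \<xi> Q x p - 2 * \<mu> / Q * (\<Sum>j\<leftarrow>p. norm (x j))\<bar> \<le> tour_length x p 0"
proof -
  define m where "m = length p"
  define S where "S j \<omega> = (\<Sum>k<j. \<xi> (p ! k) \<omega>)" for j \<omega>
  \<comment> \<open>The expected number of positive multiples of \<open>Q\<close> strictly below the
    demand of the first \<open>j\<close> customers, that is, of failures so far.\<close>
  define a where "a j = (\<Sum>l. prob {\<omega>\<in>space M. real (Suc l) * Q < S j \<omega>})" for j
  have S_int: "integrable M (S j)" if "j \<le> m" for j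
    unfolding S_def using that int by (auto simp: m_def)
  have S_meas: "S j \<in> borel_measurable M" if "j \<le> m" for j
    using S_int[OF that] by simp
  have S_nonneg: "0 \<le> S j \<omega>" if "j \<le> m" "\<omega> \<in> space M" for j \<omega>
    unfolding S_def using that by (auto intro!: sum_nonneg nonneg simp: m_def)
  have ES: "expectation (S j) = j * \<mu>" if "j \<le> m" for j
  proof -
    have "expectation (S j) = (\<Sum>k<j. expectation (\<xi> (p ! k)))"
      unfolding S_def using that by (intro Bochner_Integration.integral_sum int) (auto simp: m_def)
    also have "\<dots> = (\<Sum>k<j. \<mu>)"
      using that by (intro sum.cong refl mean) (auto simp: m_def)
    finally show ?thesis by simp
  qed
  note tails = tail_sum_bounds[OF \<open>Q > 0\<close> S_int S_nonneg]
  \<comment> \<open>The summation by parts asks for weights in \<open>[0, 1]\<close> at every index,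
    hence the default 0 beyond the path.\<close>
  define \<theta> where "\<theta> j = (if j \<le> m then j * \<mu> / Q - a j else 0)" for j
  have \<theta>: "0 \<le> \<theta> j \<and> \<theta> j \<le> 1" for j
    using tails(2,3)[of j] by (auto simp: \<theta>_def a_def ES)
  have "a 0 = 0"
  proof -
    have "{\<omega>\<in>space M. real (Suc l) * Q < S 0 \<omega>} = {}" for l
      using \<open>Q > 0\<close> by (auto simp: S_def not_less)
    then show ?thesis by (simp only: a_def) simp
  qed
  then have "\<theta> 0 = 0" by (simp add: \<theta>_def)
  \<comment> \<open>As demands are nonnegative, the events that a multiple of \<open>Q\<close> has
    been passed grow with \<open>j\<close>; a failure at position \<open>j\<close> is the difference
    of two consecutive ones.\<close>
  have step: "(\<Sum>l. prob {\<omega>\<in>space M. S j \<omega> \<le> real (Suc l) * Q \<and> real (Suc l) * Q < S (Suc j) \<omega>} * c)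
      = (a (Suc j) - a j) * c" if "j < m" for j c
  proof -
    have Sj [measurable]: "S j \<in> borel_measurable M" "S (Suc j) \<in> borel_measurable M"
      using that by (auto intro: S_meas)
    have mono: "S j \<omega> \<le> S (Suc j) \<omega>" if "\<omega> \<in> space M" for \<omega>
      using that \<open>j < m\<close> nonneg[of "p ! j" \<omega>] by (simp add: S_def m_def)
    have "prob {\<omega>\<in>space M. S j \<omega> \<le> real (Suc l) * Q \<and> real (Suc l) * Q < S (Suc j) \<omega>} =
        prob {\<omega>\<in>space M. real (Suc l) * Q < S (Suc j) \<omega>} - prob {\<omega>\<in>space M. real (Suc l) * Q < S j \<omega>}"
      for l
    proof -
      have "{\<omega>\<in>space M. S j \<omega> \<le> real (Suc l) * Q \<and> real (Suc l) * Q < S (Suc j) \<omega>} =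
        {\<omega>\<in>space M. real (Suc l) * Q < S (Suc j) \<omega>} - {\<omega>\<in>space M. real (Suc l) * Q < S j \<omega>}"
        by auto
      also have "prob \<dots> = prob {\<omega>\<in>space M. real (Suc l) * Q < S (Suc j) \<omega>} -
          prob {\<omega>\<in>space M. real (Suc l) * Q < S j \<omega>}"
        using mono by (intro finite_measure_Diff) (auto intro: less_le_trans)
      finally show ?thesis .
    qed
    then show ?thesis
      using tails(1)[of j] tails(1)[of "Suc j"] that
      by (simp add: a_def suminf_diff summable_diff flip: suminf_mult2 del: of_nat_Suc)
  qed
  have "dtd_recourse M \<xi> Q x p = (\<Sum>j<m. (a (Suc j) - a j) * failure_cost x (p ! j))"
    unfolding dtd_recourse_def m_def[symmetric]
    by (intro sum.cong refl) (simp add: step flip: S_def lessThan_Suc_atMost del: of_nat_Suc sum.lessThan_Suc)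
  \<comment> \<open>\<open>a (Suc j) - a j\<close> equals \<open>\<mu> / Q\<close> minus the
    increment of \<theta>.\<close>
  also have "\<dots> = (\<Sum>j<m. 2 * \<mu> / Q * norm (x (p ! j)) - 2 * norm (x (p ! j)) * (\<theta> (Suc j) - \<theta> j))"
    by (intro sum.cong refl) (simp add: \<theta>_def failure_cost_def algebra_simps add_divide_distrib)
  also have "\<dots> = 2 * \<mu> / Q * (\<Sum>j\<leftarrow>p. norm (x j)) -
      (\<Sum>j<m. 2 * norm (x (p ! j)) * (\<theta> (Suc j) - \<theta> j))"
    by (simp add: sum_subtractf sum_distrib_left sum_list_sum_nth m_def atLeast0LessThan)
  finally show ?thesis
    using abs_weighted_sum_le_tour_length[of \<theta> x p 0] \<theta> assms(2) by (simp add: m_def)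
qed

section \<open>Recourse under optimal restocking\<close>

lemma serve_cost_measurable:
  assumes [measurable]: "\<xi> j \<in> borel_measurable M" "F \<in> borel_measurable borel"
  shows "serve_cost M \<xi> Q x j F \<in> borel_measurable borel"
  unfolding serve_cost_def[abs_def] failures_def by measurable

text \<open>
  The failure cost \<open>2 * norm (x j)\<close> per replenishment cancels the load-dependent term of the
  cost-to-go, as a replenishment raises the load by \<open>Q\<close>; what remains is linear in the demand.
\<close>

lemma serve_cost_bound:
  assumes "Q > 0" "0 \<le> q" "q \<le> Q"
    and int: "integrable M (\<xi> j)" and nonneg: "\<And>\<omega>. \<omega> \<in> space M \<Longrightarrow> 0 \<le> \<xi> j \<omega>"
    and F [measurable]: "F \<in> borel_measurable borel"
    and bound: "\<And>q. 0 \<le> q \<Longrightarrow> q \<le> Q \<Longrightarrow> \<bar>F q - c - norm (x j) * (1 - 2 * q / Q)\<bar> \<le> T"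
  shows "\<bar>serve_cost M \<xi> Q x j F q - (c + 2 * expectation (\<xi> j) / Q * norm (x j))
           - norm (x j) * (1 - 2 * q / Q)\<bar> \<le> T"
proof -
  have [measurable]: "\<xi> j \<in> borel_measurable M"
    using int by simp
  define f where "f \<omega> = real_of_int (failures Q (\<xi> j \<omega>) q)" for \<omega>
  define load where "load \<omega> = f \<omega> * Q + q - \<xi> j \<omega>" for \<omega>
  \<comment> \<open>The error of the linear approximation to \<open>F\<close>. At the random load it
    is bounded by \<open>T\<close>, which supplies the integrability needed to split the
    expectation.\<close>
  define G where "G q = F q - c - norm (x j) * (1 - 2 * q / Q)" for q
  have [measurable]: "f \<in> borel_measurable M" "G \<in> borel_measurable borel"
    unfolding f_def[abs_def] failures_def G_def[abs_def] by measurable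
  have [measurable]: "load \<in> borel_measurable M"
    unfolding load_def[abs_def] by measurable
  have load: "load \<omega> \<in> {0..Q}" if "\<omega> \<in> space M" for \<omega>
    using failures_load[OF assms(1) nonneg[OF that] assms(2,3)] by (simp add: load_def f_def)
  have G: "\<bar>G (load \<omega>)\<bar> \<le> T" if "\<omega> \<in> space M" for \<omega>
    using bound[of "load \<omega>"] load[OF that] by (simp add: G_def)
  have "integrable M (\<lambda>\<omega>. G (load \<omega>))"
    by (rule integrable_const_bound[of _ T]) (use G in auto)
  have "serve_cost M \<xi> Q x j F q =
      expectation (\<lambda>\<omega>. G (load \<omega>) + (c + norm (x j) * (1 - 2 * q / Q) + 2 / Q * norm (x j) * \<xi> j \<omega>))"
    unfolding serve_cost_def f_def[symmetric] load_def[symmetric]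
    using \<open>Q > 0\<close>
    by (intro Bochner_Integration.integral_cong refl)
       (simp add: G_def load_def failure_cost_def field_simps)
  also have "\<dots> = expectation (\<lambda>\<omega>. G (load \<omega>)) + (c + norm (x j) * (1 - 2 * q / Q)
      + 2 / Q * norm (x j) * expectation (\<xi> j))"
    using int \<open>integrable M (\<lambda>\<omega>. G (load \<omega>))\<close> by (simp add: prob_space)
  finally have eq: "serve_cost M \<xi> Q x j F q - (c + 2 * expectation (\<xi> j) / Q * norm (x j))
           - norm (x j) * (1 - 2 * q / Q) = expectation (\<lambda>\<omega>. G (load \<omega>))"
    by simp
  have "\<bar>expectation (\<lambda>\<omega>. G (load \<omega>))\<bar> \<le> expectation (\<lambda>\<omega>. \<bar>G (load \<omega>)\<bar>)"
    by (rule integral_abs_bound)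
  also have "\<dots> \<le> T"
    using \<open>integrable M (\<lambda>\<omega>. G (load \<omega>))\<close> G by (intro integral_le_const) auto
  finally show ?thesis
    unfolding eq .
qed

text \<open>The bound covers every load in \<open>[0, Q]\<close> because the next load is random,
  and measurability is carried along because \<open>serve_cost_bound\<close> requires it. Continuing
  moves the load term from \<open>i\<close> to \<open>j\<close>, within the cost of the leg; the
  option to return only lowers the minimum, so it matters for the lower bound alone.\<close>

lemma cost_to_go_bound:
  assumes "Q > 0"
    and int: "\<And>j. j \<in> set js \<Longrightarrow> integrable M (\<xi> j)"
    and nonneg: "\<And>j \<omega>. j \<in> set js \<Longrightarrow> \<omega> \<in> space M \<Longrightarrow> 0 \<le> \<xi> j \<omega>"
    and mean: "\<And>j. j \<in> set js \<Longrightarrow> expectation (\<xi> j) = \<mu>"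
  shows "cost_to_go M \<xi> Q x js i \<in> borel_measurable borel \<and>
    (\<forall>q. 0 \<le> q \<and> q \<le> Q \<longrightarrow>
      \<bar>cost_to_go M \<xi> Q x js i q - 2 * \<mu> / Q * (\<Sum>j\<leftarrow>js. norm (x j)) - norm (x i) * (1 - 2 * q / Q)\<bar>
        \<le> tour_length x js i)"
  using int nonneg mean
proof (induction js arbitrary: i)
  case Nil
  have "\<bar>norm (x i) * (1 - 2 * q / Q)\<bar> \<le> norm (x i)" if "0 \<le> q" "q \<le> Q" for q
    using abs_norm_diff_mult_le_dist[of "1 - 2 * q / Q" "x i" 0] that \<open>Q > 0\<close>
    by (simp add: abs_le_iff field_simps)
  moreover have "cost_to_go M \<xi> Q x [] i = (\<lambda>q. 0)"
    by (simp add: fun_eq_iff)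
  ultimately show ?case
    by simp
next
  case (Cons j js)
  let ?F = "cost_to_go M \<xi> Q x js j"
  let ?H = "serve_cost M \<xi> Q x j ?F"
  let ?c = "2 * \<mu> / Q * (\<Sum>j\<leftarrow>js. norm (x j))"
  have IH: "?F \<in> borel_measurable borel \<and> (\<forall>q. 0 \<le> q \<and> q \<le> Q \<longrightarrow>
      \<bar>?F q - ?c - norm (x j) * (1 - 2 * q / Q)\<bar> \<le> tour_length x js j)"
    by (rule Cons.IH) (auto intro: Cons.prems)
  have H: "?H \<in> borel_measurable borel"
    using IH Cons.prems(1)[of j] by (intro serve_cost_measurable) auto
  have bound: "\<bar>?H q - (?c + 2 * \<mu> / Q * norm (x j)) - norm (x j) * (1 - 2 * q / Q)\<bar> \<le> tour_length x js j"
    if "0 \<le> q" "q \<le> Q" for q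
    using serve_cost_bound[of Q q \<xi> j ?F ?c x "tour_length x js j"] that IH \<open>Q > 0\<close> Cons.prems
    by simp
  have eq: "cost_to_go M \<xi> Q x (j # js) i = (\<lambda>q. min (?H q) (preventive_cost x i j + ?H Q))"
    by (simp add: fun_eq_iff)
  show ?case
  proof (intro conjI allI impI)
    show "cost_to_go M \<xi> Q x (j # js) i \<in> borel_measurable borel"
      unfolding eq using H by measurable
    fix q assume q: "0 \<le> q \<and> q \<le> Q"
    have t: "\<bar>1 - 2 * q / Q\<bar> \<le> 1"
      using q \<open>Q > 0\<close> by (simp add: abs_le_iff field_simps)
    have d: "\<bar>norm (x i) * (1 - 2 * q / Q) - norm (x j) * (1 - 2 * q / Q)\<bar> \<le> dist (x i) (x j)"
      using abs_norm_diff_mult_le_dist[OF t, of "x i" "x j"] by (simp add: left_diff_distrib)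
    \<comment> \<open>For the return branch: a full load has load term \<open>- norm (x j)\<close>,
      which cancels \<open>norm (x j)\<close> in the preventive cost and leaves
      \<open>norm (x i) - dist (x i) (x j)\<close> to compare.\<close>
    have "norm (x i) * (1 - 2 * q / Q) \<le> norm (x i)"
      using t by (intro mult_left_le) auto
    moreover have "\<bar>?H Q - (?c + 2 * \<mu> / Q * norm (x j)) + norm (x j)\<bar> \<le> tour_length x js j"
      using bound[of Q] \<open>Q > 0\<close> by simp
    moreover have "2 * \<mu> / Q * (\<Sum>j\<leftarrow>j # js. norm (x j)) = ?c + 2 * \<mu> / Q * norm (x j)"
      by (simp add: algebra_simps)
    ultimately show "\<bar>cost_to_go M \<xi> Q x (j # js) i q - 2 * \<mu> / Q * (\<Sum>j\<leftarrow>j # js. norm (x j))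
        - norm (x i) * (1 - 2 * q / Q)\<bar> \<le> tour_length x (j # js) i"
      using bound[of q] q d unfolding eq tour_length.simps preventive_cost_def min_def
      by (auto simp: abs_le_iff)
  qed
qed

section \<open>Recourse under either policy\<close>

text \<open>Reversal changes neither the customer set nor the length, so both directions satisfy the
  same bound and so does their minimum.\<close>

lemma recourse_bound:
  assumes "Q > 0" "x 0 = 0" "distinct p"
    and int: "\<And>j. j \<in> set p \<Longrightarrow> integrable M (\<xi> j)"
    and nonneg: "\<And>j \<omega>. j \<in> set p \<Longrightarrow> \<omega> \<in> space M \<Longrightarrow> 0 \<le> \<xi> j \<omega>"
    and mean: "\<And>j. j \<in> set p \<Longrightarrow> expectation (\<xi> j) = \<mu>"
  shows "\<bar>recourse \<pi> M \<xi> Q x p - 2 * \<mu> / Q * (\<Sum>j\<in>set p. norm (x j))\<bar> \<le> path_length x p"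
proof -
  have "\<bar>directed_recourse \<pi> M \<xi> Q x p' - 2 * \<mu> / Q * (\<Sum>j\<in>set p'. norm (x j))\<bar> \<le> path_length x p'"
    if p': "distinct p'" "set p' = set p" for p'
  proof (cases \<pi>)
    case DTD
    then show ?thesis
      using dtd_recourse_bound[of Q x p' \<xi> \<mu>] assms p'
      by (simp add: sum_list_distinct_conv_sum_set path_length_eq_tour_length)
  next
    \<comment> \<open>The route starts at the depot, where \<open>norm (x 0) = 0\<close> removes the
      load term.\<close>
    case OR
    then show ?thesis
      using cost_to_go_bound[of Q p' \<xi> \<mu> x 0] assms p'
      by (auto simp: sum_list_distinct_conv_sum_set path_length_eq_tour_length)
  qed
  from this[of p] this[of "rev p"] show ?thesis
    using assms(3) by (simp add: recourse_def path_length_rev min_def)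
qed

end

section \<open>Almost sure convergence\<close>

theorem theorem11:
  fixes M :: "'a measure"
    and R :: "(real^2) set"
    and X :: "nat \<Rightarrow> 'a \<Rightarrow> real^2"
    and \<xi> :: "nat \<Rightarrow> 'a \<Rightarrow> real"
    and Q \<mu> d :: real
    and \<pi> :: policy
  assumes "prob_space M"
    and "compact R"
    and "\<And>i \<omega>. i \<ge> 1 \<Longrightarrow> \<omega> \<in> space M \<Longrightarrow> X i \<omega> \<in> R \<and> \<xi> i \<omega> \<ge> 0"
    and "prob_space.indep_vars M (\<lambda>_. borel) (\<lambda>i \<omega>. (X i \<omega>, \<xi> i \<omega>)) {1..}"
    and "\<And>i. i \<ge> 1 \<Longrightarrow>
           distr M borel (\<lambda>\<omega>. (X i \<omega>, \<xi> i \<omega>)) = distr M borel (\<lambda>\<omega>. (X 1 \<omega>, \<xi> 1 \<omega>))"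
    and "\<And>i. i \<ge> 1 \<Longrightarrow>
           prob_space.indep_set M {X i -` A \<inter> space M | A. A \<in> sets borel}
                                  {\<xi> i -` B \<inter> space M | B. B \<in> sets borel}"
    and "\<And>\<omega>. \<omega> \<in> space M \<Longrightarrow> X 0 \<omega> = 0"
    and "Q > 0"
    and "integrable M (\<xi> 1)" and "\<mu> = (\<integral>\<omega>. \<xi> 1 \<omega> \<partial>M)" and "\<mu> > 0"
    and "integrable M (\<lambda>\<omega>. norm (X 1 \<omega>))" and "d = (\<integral>\<omega>. norm (X 1 \<omega>) \<partial>M)" and "d > 0"
  shows "AE \<omega> in M.
           (\<lambda>n. vrpsd_value \<pi> M \<xi> Q (\<lambda>i. X i \<omega>) n / real n) \<longlonglongrightarrow> 2 * \<mu> * d / Q"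
proof -
  interpret prob_space M by fact
  define Z where "Z i \<omega> = (X i \<omega>, \<xi> i \<omega>)" for i \<omega>
  have indep: "indep_vars (\<lambda>_. borel) Z {1..}"
    using assms(4) by (simp add: Z_def[abs_def])
  have Z [measurable]: "Z i \<in> borel_measurable M" if "i \<ge> 1" for i
    using indep that by (auto simp: indep_vars_def)
  have Z_distr: "distr M borel (Z i) = distr M borel (Z 1)" if "i \<ge> 1" for i
    unfolding Z_def[abs_def] by (rule assms(5)[OF that])
  \<comment> \<open>Real functionals of the pair inherit the common law; applied to the demand and
    to the norm of the location.\<close>
  have distr_comp: "distr M borel (\<lambda>\<omega>. f (Z i \<omega>)) = distr M borel (\<lambda>\<omega>. f (Z 1 \<omega>))"
    if "i \<ge> 1" and f: "f \<in> borel_measurable borel" for i and f :: "(real^2) \<times> real \<Rightarrow> real"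
  proof -
    have "distr M borel (\<lambda>\<omega>. f (Z k \<omega>)) = distr (distr M borel (Z k)) borel f" if "k \<ge> 1" for k
      by (subst distr_distr[OF f Z[OF that]]) (simp add: comp_def)
    from this[of i] this[of 1] show ?thesis
      by (simp only: Z_distr[OF that(1)] that(1) order_refl)
  qed
  have snd: "(snd :: (real^2) \<times> real \<Rightarrow> real) \<in> borel_measurable borel"
    by (intro borel_measurable_continuous_onI continuous_intros)
  have \<xi>_distr: "distr M borel (\<xi> i) = distr M borel (\<xi> 1)" if "i \<ge> 1" for i
    using distr_comp[OF that snd] by (simp only: Z_def snd_conv)
  have \<xi>_meas: "\<xi> i \<in> borel_measurable M" if "i \<ge> 1" for i
    using measurable_compose[OF Z[OF that] snd] by (simp only: Z_def snd_conv)
  note \<xi>_1 = \<xi>_meas[of 1, OF order_refl]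
  \<comment> \<open>Integrability is assumed for \<open>\<xi> 1\<close>; it depends only on the law
    and so passes to every customer, as does the mean.\<close>
  have \<xi>_int: "integrable M (\<xi> i)" if "i \<ge> 1" for i
  proof -
    have "integrable (distr M borel (\<xi> 1)) (\<lambda>t. t)"
      by (subst integrable_distr_eq[OF \<xi>_1]) (use assms(9) in simp_all)
    then show ?thesis
      unfolding \<xi>_distr[OF that, symmetric] by (rule integrable_distr[OF \<xi>_meas[OF that]])
  qed
  have \<xi>_mean: "expectation (\<xi> i) = \<mu>" if "i \<ge> 1" for i
  proof -
    have "expectation (\<xi> i) = integral\<^sup>L (distr M borel (\<xi> i)) (\<lambda>t. t)"
      by (rule integral_distr[OF \<xi>_meas[OF that], symmetric]) simp
    also have "\<dots> = integral\<^sup>L (distr M borel (\<xi> 1)) (\<lambda>t. t)"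
      by (simp only: \<xi>_distr[OF that])
    also have "\<dots> = \<mu>"
      unfolding assms(10) by (rule integral_distr[OF \<xi>_1]) simp
    finally show ?thesis .
  qed
  have nf: "(\<lambda>z :: (real^2) \<times> real. norm (fst z)) \<in> borel_measurable borel"
    by (intro borel_measurable_continuous_onI continuous_intros)
  obtain B where B: "B > 0" "\<And>r. r \<in> R \<Longrightarrow> norm r \<le> B"
    using compact_imp_bounded[OF assms(2)] bounded_pos by metis
  have "AE \<omega> in M. (\<lambda>n. (\<Sum>i=1..n. norm (X i \<omega>)) / n) \<longlonglongrightarrow> expectation (\<lambda>\<omega>. norm (X 1 \<omega>))"
  proof (rule strong_law_bounded)
    show "indep_vars (\<lambda>_. borel) (\<lambda>i \<omega>. norm (X i \<omega>)) {1..}"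
      using indep_vars_compose2[OF indep, of "\<lambda>_ z. norm (fst z)" "\<lambda>_. borel"] nf by (simp add: Z_def del: One_nat_def)
    show "distr M borel (\<lambda>\<omega>. norm (X i \<omega>)) = distr M borel (\<lambda>\<omega>. norm (X 1 \<omega>))" if "i \<ge> 1" for i
      using distr_comp[OF that nf] by (simp only: Z_def fst_conv)
    show "AE \<omega> in M. norm (X 1 \<omega>) \<in> {0..B}"
      using assms(3)[of 1] B(2) by (intro AE_I2) auto
  qed (rule B(1))
  then show ?thesis
    using AE_space
  proof eventually_elim
    case (elim \<omega>)
    \<comment> \<open>The locations are frozen at an outcome \<omega> whose average norms converge,
      while the expectations inside the recourse still range over the demands.\<close>
    have "(\<lambda>n. vrpsd_value \<pi> M \<xi> Q (\<lambda>i. X i \<omega>) n / n) \<longlonglongrightarrow> 2 * \<mu> / Q * d"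
    proof (rule vrpsd_value_asymptotics)
      fix p :: "nat list" assume "distinct p" "0 \<notin> set p"
      then have "j \<ge> 1" if "j \<in> set p" for j
        using that by (cases j) auto
      then show "\<bar>recourse \<pi> M \<xi> Q (\<lambda>i. X i \<omega>) p - 2 * \<mu> / Q * (\<Sum>i\<in>set p. norm (X i \<omega>))\<bar>
          \<le> path_length (\<lambda>i. X i \<omega>) p"
        using assms(3,7,8) elim(2) \<open>distinct p\<close> \<xi>_int \<xi>_mean by (intro recourse_bound) auto
    qed (use assms(2,3,7,13) elim in auto)
    then show ?case
      by simp
  qed
qed

end
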